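(* Let $\gamma: I\to\mathbb{R}^3$ be a curve parametrized by its arclength parameter $s$, with curvature $\kappa_\gamma>0$ and torsion $\tau_\gamma$. Put $\rho=\tau_\gamma/\kappa_\gamma$ and assume that $\rho'\neq0$ everywhere on $I$. Then $\gamma$ is a proper concircular helix if and only if there is a nonzero constant $m\in\mathbb{R}$ such that $$\left(\frac{\rho'}{\kappa_\gamma(1+\rho^2)^{3/2}}\right)'= m\,\frac{\rho''}{\kappa_\gamma^2(1+\rho^2)^{5/2}}\qquad\text{on } I.$$ Moreover, in this case, if $\lambda,\mu$ are nonzero constants with $\mu=-\lambda m$, and $$b=\frac{1}{\rho'}\big(\mu+\lambda\kappa_\gamma(1+\rho^2)\big),\qquad V=b\,(\rho\, T_\gamma+B_\gamma)+\lambda N_\gamma ,$$ then the vector field $V$ along $\gamma$ extends to a concircular vector field $Y(p)=\mu p+v$ on $\mathbb{R}^3$ (that is, $V(s)=\mu\gamma(s)+v$ for some constant vector $v\in\mathbb{R}^3$), and $Y$ is a concircular vector field (axis) for the proper concircular helix $\gamma$, with $\langle N_\gamma,Y\rangle=\lambda$ along $\gamma$.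
   Context: Curves are smooth. $\{T_\gamma,N_\gamma,B_\gamma\}$ is the Frenet frame of $\gamma$, with $T_\gamma'=\kappa_\gamma N_\gamma$, $N_\gamma'=-\kappa_\gamma T_\gamma+\tau_\gamma B_\gamma$, $B_\gamma'=-\tau_\gamma N_\gamma$. Primes denote derivatives with respect to $s$. A concircular vector field on $\mathbb{R}^3$ is a vector field of the form $Y(p)=\mu p+v$ with constants $\mu\in\mathbb{R}$, $v\in\mathbb{R}^3$. A unit speed curve $\gamma$ with $\kappa_\gamma>0$ is a concircular helix with axis $Y$ if $\lambda:=\langle N_\gamma,Y\rangle$ is constant along $\gamma$. It is a proper concircular helix if it is a concircular helix for some axis $Y(p)=\mu p+v$ with $\lambda\mu\neq0$. *)

theory Defs
  imports "HOL-Analysis.Analysis"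
begin

text \<open>The derivative relative to \<open>I\<close> is the ordinary one at interior points of \<open>I\<close> and
  the one-sided one at an end point belonging to \<open>I\<close>.\<close>

definition deriv_on :: "real set \<Rightarrow> (real \<Rightarrow> 'a::real_normed_vector) \<Rightarrow> real \<Rightarrow> 'a" where
  "deriv_on I f s = vector_derivative f (at s within I)"

definition smooth_on :: "real set \<Rightarrow> (real \<Rightarrow> 'a::real_normed_vector) \<Rightarrow> bool" where
  "smooth_on I f \<longleftrightarrow> (\<forall>n. ((deriv_on I ^^ n) f) differentiable_on I)"

definition unit_speed_curve :: "real set \<Rightarrow> (real \<Rightarrow> real^3) \<Rightarrow> bool" where
  "unit_speed_curve I \<gamma> \<longleftrightarrow>
     is_interval I \<and> interior I \<noteq> {} \<and> smooth_on I \<gamma> \<and> (\<forall>s\<in>I. norm (deriv_on I \<gamma> s) = 1)"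

text \<open>The definitions of \<open>frenet_N\<close>, \<open>frenet_B\<close> and \<open>torsion\<close> are meaningful only where the
  curvature is positive; see \<open>frenet_equations\<close>.\<close>

definition frenet_T :: "real set \<Rightarrow> (real \<Rightarrow> real^3) \<Rightarrow> real \<Rightarrow> real^3" where
  "frenet_T I \<gamma> = deriv_on I \<gamma>"

definition curvature :: "real set \<Rightarrow> (real \<Rightarrow> real^3) \<Rightarrow> real \<Rightarrow> real" where
  "curvature I \<gamma> s = norm (deriv_on I (frenet_T I \<gamma>) s)"

definition frenet_N :: "real set \<Rightarrow> (real \<Rightarrow> real^3) \<Rightarrow> real \<Rightarrow> real^3" where
  "frenet_N I \<gamma> s = deriv_on I (frenet_T I \<gamma>) s /\<^sub>R curvature I \<gamma> s"

definition frenet_B :: "real set \<Rightarrow> (real \<Rightarrow> real^3) \<Rightarrow> real \<Rightarrow> real^3" where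
  "frenet_B I \<gamma> s = cross3 (frenet_T I \<gamma> s) (frenet_N I \<gamma> s)"

definition torsion :: "real set \<Rightarrow> (real \<Rightarrow> real^3) \<Rightarrow> real \<Rightarrow> real" where
  "torsion I \<gamma> s = - (deriv_on I (frenet_B I \<gamma>) s \<bullet> frenet_N I \<gamma> s)"

definition concircular_field :: "real \<Rightarrow> real^3 \<Rightarrow> real^3 \<Rightarrow> real^3" where
  "concircular_field \<mu> v p = \<mu> *\<^sub>R p + v"

definition concircular_helix_with_axis ::
  "real set \<Rightarrow> (real \<Rightarrow> real^3) \<Rightarrow> (real^3 \<Rightarrow> real^3) \<Rightarrow> bool" where
  "concircular_helix_with_axis I \<gamma> Y \<longleftrightarrow>
     unit_speed_curve I \<gamma> \<and> (\<forall>s\<in>I. curvature I \<gamma> s > 0) \<and>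
     (\<exists>\<mu> v. Y = concircular_field \<mu> v) \<and>
     (\<exists>l. \<forall>s\<in>I. frenet_N I \<gamma> s \<bullet> Y (\<gamma> s) = l)"

definition proper_concircular_helix :: "real set \<Rightarrow> (real \<Rightarrow> real^3) \<Rightarrow> bool" where
  "proper_concircular_helix I \<gamma> \<longleftrightarrow>
     (\<exists>\<mu> v l. concircular_helix_with_axis I \<gamma> (concircular_field \<mu> v) \<and>
        (\<forall>s\<in>I. frenet_N I \<gamma> s \<bullet> concircular_field \<mu> v (\<gamma> s) = l) \<and> l * \<mu> \<noteq> 0)"

lemma cross3_frame_expansion:
  fixes t n x :: "real^3"
  assumes "norm t = 1" "norm n = 1" "t \<bullet> n = 0"
  shows "x = (x \<bullet> t) *\<^sub>R t + (x \<bullet> n) *\<^sub>R n + (x \<bullet> cross3 t n) *\<^sub>R cross3 t n"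
proof -
  define b where "b = cross3 t n"
  define y where "y = x - ((x \<bullet> t) *\<^sub>R t + (x \<bullet> n) *\<^sub>R n + (x \<bullet> b) *\<^sub>R b)"
  have tt: "t \<bullet> t = 1" "n \<bullet> n = 1"
    using assms by (auto simp: dot_square_norm)
  have bb: "t \<bullet> b = 0" "n \<bullet> b = 0" "b \<bullet> t = 0" "b \<bullet> n = 0" "n \<bullet> t = 0"
    unfolding b_def using assms by (auto simp: dot_cross_self inner_commute)
  have nb: "norm b = 1"
    using norm_cross_dot[of t n] assms norm_ge_zero[of b] unfolding b_def
    by (auto simp: power2_eq_1_iff)
  then have b1: "b \<bullet> b = 1" by (simp add: dot_square_norm)
  have y0: "y \<bullet> t = 0" "y \<bullet> n = 0" "y \<bullet> b = 0"
    unfolding y_def using tt bb b1 assms(3)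
    by (auto simp: inner_diff_left inner_add_left)
  have "cross3 b y = (t \<bullet> y) *\<^sub>R n - (n \<bullet> y) *\<^sub>R t"
    unfolding b_def by (simp add: cross3_simps forall_3)
  then have "cross3 b y = 0" "b \<bullet> y = 0"
    using y0 by (auto simp: inner_commute)
  then have "y = 0"
    using norm_and_cross_eq_0[of b y] nb by auto
  then show ?thesis unfolding y_def b_def by simp
qed

lemma has_real_derivative_const_on_imp_0:
  fixes f :: "real \<Rightarrow> real"
  assumes "at s within I \<noteq> bot" "s \<in> I" "(f has_vector_derivative x) (at s within I)"
    and "\<And>t. t \<in> I \<Longrightarrow> f t = c"
  shows "x = 0"
proof -
  have "((\<lambda>_. c) has_vector_derivative x) (at s within I)"
    using has_vector_derivative_transform[OF assms(2), of "\<lambda>_. c" f x] assms by auto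
  then show ?thesis
    using vector_derivative_unique_within[OF assms(1) _ has_vector_derivative_const] by blast
qed

lemma has_vector_derivative_inner_within:
  fixes f g :: "real \<Rightarrow> real^3"
  assumes "(f has_vector_derivative f') (at s within I)" "(g has_vector_derivative g') (at s within I)"
  shows "((\<lambda>t. f t \<bullet> g t) has_vector_derivative f s \<bullet> g' + f' \<bullet> g s) (at s within I)"
  by (rule bounded_bilinear.has_vector_derivative[OF bounded_bilinear_inner assms])

lemma unit_speed_curve_frame:
  assumes "unit_speed_curve I \<gamma>" "\<forall>s\<in>I. curvature I \<gamma> s > 0" "s \<in> I"
  shows "at s within I \<noteq> bot"
    and "norm (frenet_T I \<gamma> s) = 1"
    and "norm (frenet_N I \<gamma> s) = 1"
    and "frenet_T I \<gamma> s \<bullet> frenet_N I \<gamma> s = 0"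
    and "(frenet_T I \<gamma> has_vector_derivative curvature I \<gamma> s *\<^sub>R frenet_N I \<gamma> s) (at s within I)"
    and "frenet_N I \<gamma> differentiable (at s within I)"
proof -
  let ?T = "frenet_T I \<gamma>" and ?N = "frenet_N I \<gamma>" and ?k = "curvature I \<gamma>"
  let ?A = "deriv_on I ?T"
  let ?F = "at s within I"
  have sm: "smooth_on I \<gamma>" and un: "\<And>t. t \<in> I \<Longrightarrow> norm (?T t) = 1"
    and int: "is_interval I" "interior I \<noteq> {}"
    using assms(1) by (auto simp: unit_speed_curve_def frenet_T_def)
  show "norm (?T s) = 1" using un assms(3) .
  have "connected I" using int(1) by (simp add: is_interval_connected)
  moreover have "I \<noteq> {x}" for x using int(2) by auto
  ultimately have "s islimpt I" using connected_imp_perfect assms(3) by blast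
  then show nb: "?F \<noteq> bot" by (simp add: trivial_limit_within)
  have "((deriv_on I ^^ n) \<gamma>) differentiable ?F" for n
    using sm assms(3) by (simp add: smooth_on_def differentiable_on_def)
  from this[of "Suc 0"] this[of "Suc (Suc 0)"]
  have Td: "?T differentiable ?F" and Ad: "?A differentiable ?F"
    by (simp_all add: frenet_T_def)
  have k0: "?k s > 0" using assms by auto
  have "(?T has_vector_derivative ?A s) ?F"
    using Td unfolding deriv_on_def by (simp add: vector_derivative_works)
  moreover have "?A s = ?k s *\<^sub>R ?N s"
    using k0 unfolding frenet_N_def by simp
  ultimately show T1: "(?T has_vector_derivative ?k s *\<^sub>R ?N s) ?F" by simp
  show "norm (?N s) = 1"
    using k0 unfolding frenet_N_def curvature_def by simp
  have "?T s \<bullet> (?k s *\<^sub>R ?N s) + (?k s *\<^sub>R ?N s) \<bullet> ?T s = 0"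
    by (rule has_real_derivative_const_on_imp_0[OF nb assms(3)
        has_vector_derivative_inner_within[OF T1 T1], of 1])
      (simp add: un dot_square_norm)
  then show "?T s \<bullet> ?N s = 0" using k0 by (simp add: inner_commute)
  have A0: "?A s \<noteq> 0" using k0 by (auto simp: curvature_def)
  have "norm differentiable (at (?A s))"
    using differentiable_norm_at[OF A0] .
  then have "norm differentiable (at (?A s) within ?A ` I)"
    by (rule differentiable_at_withinI)
  from differentiable_chain_within[OF Ad this]
  have "(\<lambda>t. norm (?A t)) differentiable ?F" by (simp add: o_def)
  then have "(\<lambda>t. inverse (norm (?A t)) *\<^sub>R ?A t) differentiable ?F"
    using A0 Ad by (intro differentiable_scaleR differentiable_inverse) auto
  then show "?N differentiable ?F" by (simp add: frenet_N_def[abs_def] curvature_def)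
qed

lemma frenet_equations:
  assumes "unit_speed_curve I \<gamma>" "\<forall>s\<in>I. curvature I \<gamma> s > 0" "s \<in> I"
  shows "(frenet_T I \<gamma> has_vector_derivative curvature I \<gamma> s *\<^sub>R frenet_N I \<gamma> s) (at s within I)"
    and "(frenet_N I \<gamma> has_vector_derivative
            - curvature I \<gamma> s *\<^sub>R frenet_T I \<gamma> s + torsion I \<gamma> s *\<^sub>R frenet_B I \<gamma> s) (at s within I)"
    and "(frenet_B I \<gamma> has_vector_derivative - torsion I \<gamma> s *\<^sub>R frenet_N I \<gamma> s) (at s within I)"
proof -
  let ?T = "frenet_T I \<gamma>" and ?N = "frenet_N I \<gamma>" and ?B = "frenet_B I \<gamma>"
    and ?k = "curvature I \<gamma>" and ?t = "torsion I \<gamma>"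
  let ?F = "at s within I"
  note fr = unit_speed_curve_frame[OF assms(1,2)]
  note const = has_real_derivative_const_on_imp_0[OF fr(1)[OF assms(3)] assms(3)
      has_vector_derivative_inner_within]
  show T1: "(?T has_vector_derivative ?k s *\<^sub>R ?N s) ?F" using fr(5) assms(3) .
  define n where "n = vector_derivative ?N ?F"
  have N1: "(?N has_vector_derivative n) ?F"
    using fr(6)[OF assms(3)] unfolding n_def by (simp add: vector_derivative_works)
  have "?N s \<bullet> n + n \<bullet> ?N s = 0"
    by (rule const[OF N1 N1, of 1]) (simp add: fr dot_square_norm)
  then have nN: "n \<bullet> ?N s = 0" by (simp add: inner_commute)
  have "?T s \<bullet> n + (?k s *\<^sub>R ?N s) \<bullet> ?N s = 0"
    by (rule const[OF T1 N1, of 0]) (simp add: fr)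
  then have nT: "n \<bullet> ?T s = - ?k s"
    using fr(3)[OF assms(3)] by (simp add: inner_commute dot_square_norm)
  have "(?B has_vector_derivative cross3 (?T s) n + cross3 (?k s *\<^sub>R ?N s) (?N s)) ?F"
    unfolding frenet_B_def[abs_def]
    using bilinear_cross T1 N1
    by (intro bounded_bilinear.has_vector_derivative) (simp_all add: bilinear_conv_bounded_bilinear)
  then have B1: "(?B has_vector_derivative cross3 (?T s) n) ?F"
    by (simp add: cross_mult_left)
  then have "deriv_on I ?B s = cross3 (?T s) n"
    unfolding deriv_on_def by (rule vector_derivative_within[OF fr(1)[OF assms(3)]])
  then have t: "?t s = n \<bullet> ?B s"
    unfolding torsion_def frenet_B_def by (simp add: cross3_simps)
  have n: "n = - ?k s *\<^sub>R ?T s + ?t s *\<^sub>R ?B s"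
    using cross3_frame_expansion[OF fr(2,3,4)[OF assms(3)], of n] nN nT
    by (simp add: t frenet_B_def)
  then show "(?N has_vector_derivative - ?k s *\<^sub>R ?T s + ?t s *\<^sub>R ?B s) ?F"
    using N1 by simp
  have "cross3 (?T s) (?B s) = (?T s \<bullet> ?N s) *\<^sub>R ?T s - (?T s \<bullet> ?T s) *\<^sub>R ?N s"
    unfolding frenet_B_def by (simp add: cross3_simps forall_3)
  also have "\<dots> = - ?N s"
    using fr(2,4)[OF assms(3)] by (simp add: dot_square_norm)
  finally have TB: "cross3 (?T s) (?B s) = - ?N s" .
  have "cross3 (?T s) n = - ?t s *\<^sub>R ?N s"
    unfolding n cross_add_right cross_mult_right TB by simp
  then show "(?B has_vector_derivative - ?t s *\<^sub>R ?N s) ?F" using B1 by simp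
qed

end

theory Submission
  imports Defs
begin

text \<open>A vector field \<open>V\<close> along \<open>\<gamma>\<close> is the restriction of some \<open>Y(p) = \<mu>p + v\<close> exactly when
  \<open>V' = \<mu>T\<close>, because \<open>V - \<mu>\<gamma>\<close> is then constant on the interval. So a concircular axis is a solution
  of this equation whose normal component is a constant \<open>l\<close>. Writing \<open>V = aT + lN + bB\<close>, the Frenet
  equations split it into
  \<open>a' - l\<kappa> = \<mu>\<close>, \<open>a\<kappa> = b\<tau>\<close> and \<open>b' = - l\<tau>\<close>.
  The middle equation says \<open>a = \<rho>b\<close>; substituting this and the last equation into the first
  gives \<open>\<rho>' b = \<mu> + l\<kappa>(1 + \<rho>\<^sup>2)\<close>. As \<open>\<rho>'\<close> does not vanish, \<open>b\<close> is
  determined by \<open>l\<close> and \<open>\<mu>\<close>, and what remains is the single scalar equation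
  \<open>b' = - l\<tau>\<close>.

  The stated differential equation is that scalar equation in disguise
  (\<open>ode_iff_binormal_coefficient\<close>): put \<open>w = 1 + \<rho>\<^sup>2\<close> and
  \<open>Q = \<rho>''\<kappa>w - \<rho>'\<kappa>'w - 3\<kappa>\<rho>\<rho>'\<^sup>2\<close>. Differentiating the left-hand
  quotient gives \<open>Q\<close> over \<open>\<kappa>\<^sup>2\<close> times the \<open>5/2\<close>-th power of \<open>w\<close>, so the equation reads
  \<open>Q = m\<rho>''\<close>; differentiating \<open>b\<close> gives
  \<open>b' = - l\<tau> - (lQ + \<mu>\<rho>'')/\<rho>'\<^sup>2\<close>, so \<open>b' = - l\<tau>\<close> reads
  \<open>lQ + \<mu>\<rho>'' = 0\<close>. For \<open>l \<noteq> 0\<close> these are equivalent if \<open>\<mu> = - lm\<close>.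

  Hence an axis with constants \<open>l, \<mu>\<close> yields the equation with \<open>m = - \<mu>/l\<close>
  (\<open>concircular_axis_binormal_coefficient\<close>), and conversely the equation makes the explicit \<open>V\<close> an axis
  (\<open>frenet_combination_has_derivative\<close>, \<open>concircular_of_derivative_tangent\<close>). A nonzero
  multiple of an axis is an axis, so taking \<open>l = 1\<close> loses nothing when only existence is asked.

  All this differentiates \<open>\<rho>\<close> twice and \<open>\<kappa>\<close> once, which the smoothness of \<open>\<gamma>\<close> has to
  justify; that is the purpose of the formula expressing \<open>\<tau>\<close> by the first three derivatives of
  \<open>\<gamma>\<close>.\<close>

section \<open>Derivatives relative to an interval\<close>

lemma deriv_on_eqI:
  assumes "at s within I \<noteq> bot" "(f has_vector_derivative f') (at s within I)"
  shows "deriv_on I f s = f'"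
  unfolding deriv_on_def using assms by (rule vector_derivative_within)

lemma has_vector_derivative_deriv_on:
  assumes "f differentiable (at s within I)"
  shows "(f has_vector_derivative deriv_on I f s) (at s within I)"
  unfolding deriv_on_def using assms by (simp add: vector_derivative_works)

lemma smooth_on_has_vector_derivative:
  assumes "smooth_on I f" "s \<in> I"
  shows "((deriv_on I ^^ n) f has_vector_derivative (deriv_on I ^^ Suc n) f s) (at s within I)"
  using assms by (auto simp: smooth_on_def differentiable_on_def intro!: has_vector_derivative_deriv_on)

lemma has_vector_derivative_cross3_within:
  assumes "(f has_vector_derivative f') (at s within I)" "(g has_vector_derivative g') (at s within I)"
  shows "((\<lambda>t. cross3 (f t) (g t)) has_vector_derivative cross3 (f s) g' + cross3 f' (g s)) (at s within I)"
  using bilinear_cross assms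
  by (intro bounded_bilinear.has_vector_derivative) (simp_all add: bilinear_conv_bounded_bilinear)

section \<open>Regularity of curvature and torsion\<close>

text \<open>Differentiate \<open>\<kappa>\<^sup>2 = \<gamma>'' \<bullet> \<gamma>''\<close>; positivity of \<open>\<kappa>\<close> keeps the square root
  away from its singularity.\<close>

lemma curvature_has_real_derivative:
  assumes "unit_speed_curve I \<gamma>" "\<forall>s\<in>I. curvature I \<gamma> s > 0" "s \<in> I"
  defines "g \<equiv> \<lambda>n. (deriv_on I ^^ n) \<gamma>"
  shows "(curvature I \<gamma> has_real_derivative (g 2 s \<bullet> g 3 s) / curvature I \<gamma> s) (at s within I)"
proof -
  have sm: "smooth_on I \<gamma>" using assms(1) by (simp add: unit_speed_curve_def)
  have g3: "(g 2 has_vector_derivative g 3 s) (at s within I)"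
    using smooth_on_has_vector_derivative[OF sm assms(3), of 2] by (simp add: g_def eval_nat_numeral)
  have k: "curvature I \<gamma> = (\<lambda>t. sqrt (g 2 t \<bullet> g 2 t))"
    by (auto simp: curvature_def g_def eval_nat_numeral frenet_T_def norm_eq_sqrt_inner)
  have pos: "g 2 s \<bullet> g 2 s > 0" using assms(2,3) unfolding k by auto
  have "((\<lambda>t. g 2 t \<bullet> g 2 t) has_real_derivative (g 2 s \<bullet> g 3 s + g 3 s \<bullet> g 2 s)) (at s within I)"
    unfolding has_real_derivative_iff_has_vector_derivative
    by (rule has_vector_derivative_inner_within[OF g3 g3])
  from DERIV_chain2[OF DERIV_real_sqrt[OF pos] this] show ?thesis
    unfolding k by (simp add: inner_commute field_simps)
qed

text \<open>The torsion is defined through the derivative of \<open>B\<close>, from which its own differentiability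
  is not apparent. This formula removes the frame: \<open>\<gamma>' \<times> \<gamma>'' = \<kappa>B\<close>, and the
  \<open>B\<close>-component of the third derivative \<open>(\<kappa>N)' = \<kappa>'N + \<kappa>(-\<kappa>T + \<tau>B)\<close> is
  \<open>\<kappa>\<tau>\<close>.\<close>

lemma torsion_eq_triple_product:
  assumes "unit_speed_curve I \<gamma>" "\<forall>s\<in>I. curvature I \<gamma> s > 0" "s \<in> I"
  defines "g \<equiv> \<lambda>n. (deriv_on I ^^ n) \<gamma>"
  shows "torsion I \<gamma> s = (cross3 (g 1 s) (g 2 s) \<bullet> g 3 s) / (curvature I \<gamma> s)\<^sup>2"
proof -
  let ?T = "frenet_T I \<gamma>" and ?N = "frenet_N I \<gamma>" and ?B = "frenet_B I \<gamma>"
    and ?k = "curvature I \<gamma>" and ?t = "torsion I \<gamma>"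
  have sm: "smooth_on I \<gamma>" using assms(1) by (simp add: unit_speed_curve_def)
  note fr = unit_speed_curve_frame[OF assms(1,2)]
  have g1: "g 1 = ?T" by (simp add: g_def frenet_T_def)
  have kp: "?k t > 0" if "t \<in> I" for t using assms(2) that by auto
  have g2: "g 2 t = ?k t *\<^sub>R ?N t" if "t \<in> I" for t
    using kp[OF that] by (simp add: g_def eval_nat_numeral frenet_N_def frenet_T_def)
  have g3: "(g 2 has_vector_derivative g 3 s) (at s within I)"
    using smooth_on_has_vector_derivative[OF sm assms(3), of 2] by (simp add: g_def eval_nat_numeral)
  obtain k' where k': "(?k has_real_derivative k') (at s within I)"
    using curvature_has_real_derivative[OF assms(1-3)] by blast
  let ?N' = "- ?k s *\<^sub>R ?T s + ?t s *\<^sub>R ?B s"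
  have "((\<lambda>t. ?k t *\<^sub>R ?N t) has_vector_derivative ?k s *\<^sub>R ?N' + k' *\<^sub>R ?N s) (at s within I)"
    by (rule has_vector_derivative_scaleR[OF k' frenet_equations(2)[OF assms(1-3)]])
  then have "(g 2 has_vector_derivative ?k s *\<^sub>R ?N' + k' *\<^sub>R ?N s) (at s within I)"
    by (rule has_vector_derivative_transform[OF assms(3), rotated]) (simp add: g2)
  then have e: "g 3 s = ?k s *\<^sub>R ?N' + k' *\<^sub>R ?N s"
    using vector_derivative_unique_within[OF fr(1)[OF assms(3)] g3] by blast
  have "?B s \<bullet> ?T s = 0" "?B s \<bullet> ?N s = 0"
    by (simp_all add: frenet_B_def dot_cross_self)
  moreover have "norm (?B s) = 1"
    using norm_cross_dot[of "?T s" "?N s"] fr(2-4)[OF assms(3)]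
    unfolding frenet_B_def by (auto simp: power2_eq_1_iff) (smt (verit) norm_ge_zero)
  moreover have "cross3 (g 1 s) (g 2 s) = ?k s *\<^sub>R ?B s"
    unfolding g1 g2[OF assms(3)] by (simp add: cross_mult_right frenet_B_def)
  ultimately have "cross3 (g 1 s) (g 2 s) \<bullet> g 3 s = (?k s)\<^sup>2 * ?t s"
    by (simp add: e inner_add_right inner_diff_right power2_eq_square dot_square_norm)
  then show ?thesis using kp[OF assms(3)] by simp
qed

text \<open>By the triple product formula \<open>\<rho> = D/\<kappa>\<^sup>3\<close> with \<open>D\<close> the triple product of the first three
  derivatives of \<open>\<gamma>\<close>. In \<open>D'\<close> only the term with the fourth derivative of \<open>\<gamma>\<close> survives, so
  \<open>\<rho>'\<close> is again a rational expression in \<open>\<kappa>\<close> and inner products of derivatives of \<open>\<gamma>\<close>.\<close>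

lemma torsion_curvature_ratio_twice_differentiable:
  assumes "unit_speed_curve I \<gamma>" "\<forall>s\<in>I. curvature I \<gamma> s > 0" "s \<in> I"
  defines "\<rho> \<equiv> \<lambda>s. torsion I \<gamma> s / curvature I \<gamma> s"
  shows "(\<rho> has_real_derivative deriv_on I \<rho> s) (at s within I)"
    and "(deriv_on I \<rho> has_real_derivative deriv_on I (deriv_on I \<rho>) s) (at s within I)"
proof -
  define g where "g = (\<lambda>n. (deriv_on I ^^ n) \<gamma>)"
  let ?k = "curvature I \<gamma>"
  have sm: "smooth_on I \<gamma>" using assms(1) by (simp add: unit_speed_curve_def)
  have g: "(g n has_vector_derivative g (Suc n) t) (at t within I)" if "t \<in> I" for n t
    using smooth_on_has_vector_derivative[OF sm that, of n] by (simp add: g_def)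
  define D where "D t = cross3 (g 1 t) (g 2 t) \<bullet> g 3 t" for t
  define D' where "D' t = cross3 (g 1 t) (g 2 t) \<bullet> g 4 t" for t
  define E where "E t = g 2 t \<bullet> g 3 t" for t
  \<comment> \<open>the derivative of \<open>D / \<kappa>\<^sup>3\<close>, simplified with \<open>\<kappa>' = E / \<kappa>\<close>\<close>
  define R where "R t = (D' t * (?k t)\<^sup>2 - 3 * D t * E t) / (?k t)^5" for t
  have kp: "?k t > 0" if "t \<in> I" for t using assms(2) that by auto
  have k: "(?k has_real_derivative E t / ?k t) (at t within I)" if "t \<in> I" for t
    using curvature_has_real_derivative[OF assms(1,2) that] by (simp add: E_def g_def)
  have c: "((\<lambda>t. cross3 (g 1 t) (g 2 t)) has_vector_derivative cross3 (g 1 t) (g 3 t)) (at t within I)"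
    if "t \<in> I" for t
    using has_vector_derivative_cross3_within[OF g[OF that, of 1] g[OF that, of 2]]
    by (simp add: eval_nat_numeral)
  have D: "(D has_real_derivative D' t) (at t within I)" if "t \<in> I" for t
    using has_vector_derivative_inner_within[OF c[OF that] g[OF that, of 3]]
    unfolding has_real_derivative_iff_has_vector_derivative D_def[abs_def] D'_def
    by (simp add: dot_cross_self eval_nat_numeral)
  have D2: "\<exists>x. (D' has_real_derivative x) (at t within I)" if "t \<in> I" for t
    using has_vector_derivative_inner_within[OF c[OF that] g[OF that, of 4]]
    unfolding has_real_derivative_iff_has_vector_derivative D'_def[abs_def] by blast
  have E2: "\<exists>x. (E has_real_derivative x) (at t within I)" if "t \<in> I" for t
    using has_vector_derivative_inner_within[OF g[OF that, of 2] g[OF that, of 3]]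
    unfolding has_real_derivative_iff_has_vector_derivative E_def[abs_def] by blast
  have rho: "\<rho> t = D t / (?k t)^3" if "t \<in> I" for t
    unfolding \<rho>_def torsion_eq_triple_product[OF assms(1,2) that]
    by (simp add: D_def g_def eval_nat_numeral)
  have R: "(\<rho> has_real_derivative R t) (at t within I)" if t: "t \<in> I" for t
  proof -
    have "((\<lambda>t. D t / (?k t)^3) has_real_derivative R t) (at t within I)"
      using kp[OF t] by (auto intro!: derivative_eq_intros D[OF t] k[OF t]
          simp: R_def divide_simps) (simp add: algebra_simps eval_nat_numeral)
    then show ?thesis
      unfolding has_real_derivative_iff_has_vector_derivative
      by (rule has_vector_derivative_transform[OF t, rotated]) (simp add: rho)
  qed
  have dr: "deriv_on I \<rho> t = R t" if "t \<in> I" for t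
    by (rule deriv_on_eqI[OF unit_speed_curve_frame(1)[OF assms(1,2) that]])
      (rule R[OF that, unfolded has_real_derivative_iff_has_vector_derivative])
  show "(\<rho> has_real_derivative deriv_on I \<rho> s) (at s within I)"
    using R dr assms(3) by simp
  obtain x y where "(D' has_real_derivative x) (at s within I)" "(E has_real_derivative y) (at s within I)"
    using D2 E2 assms(3) by blast
  then have "\<exists>z. (R has_real_derivative z) (at s within I)"
    unfolding R_def[abs_def] using kp[OF assms(3)]
    by (intro exI) (rule derivative_intros D k assms | simp)+
  then obtain z where z: "(R has_vector_derivative z) (at s within I)"
    unfolding has_real_derivative_iff_has_vector_derivative by blast
  have "(deriv_on I \<rho> has_vector_derivative z) (at s within I)"
    using z by (rule has_vector_derivative_transform[OF assms(3), rotated]) (simp add: dr)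
  then show "(deriv_on I \<rho> has_real_derivative deriv_on I (deriv_on I \<rho>) s) (at s within I)"
    unfolding has_real_derivative_iff_has_vector_derivative
    by (intro has_vector_derivative_deriv_on differentiableI_vector)
qed

section \<open>The equation for the binormal coefficient\<close>

text \<open>Both sides are linear conditions on the same expression \<open>Q\<close>: the left one is
  \<open>Q = m r'\<close>, the right one is \<open>l Q + \<mu> r' = 0\<close>. The statement is local in \<open>s\<close> and concerns
  arbitrary scalar functions, with \<open>r\<close> and \<open>r'\<close> in the roles of the first two derivatives of
  \<open>\<rho>\<close>, and \<open>\<kappa> * \<rho>\<close> in that of the torsion.\<close>

lemma ode_iff_binormal_coefficient:
  fixes \<kappa> \<rho> r :: "real \<Rightarrow> real"
  assumes "at s within I \<noteq> bot"
    and k: "(\<kappa> has_real_derivative k') (at s within I)" and k0: "\<kappa> s > 0"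
    and rho: "(\<rho> has_real_derivative r s) (at s within I)" and r0: "r s \<noteq> 0"
    and r: "(r has_real_derivative r') (at s within I)"
    and l: "l \<noteq> 0" and mu: "\<mu> = - l * m"
  shows "deriv_on I (\<lambda>t. r t / (\<kappa> t * (1 + (\<rho> t)\<^sup>2) powr (3/2))) s
            = m * (r' / ((\<kappa> s)\<^sup>2 * (1 + (\<rho> s)\<^sup>2) powr (5/2)))
     \<longleftrightarrow> ((\<lambda>t. 1 / r t * (\<mu> + l * \<kappa> t * (1 + (\<rho> t)\<^sup>2))) has_real_derivative - l * (\<kappa> s * \<rho> s)) (at s within I)"
    (is "deriv_on I ?F s = _ \<longleftrightarrow> (?b has_real_derivative _) _")
proof -
  define w where "w = 1 + (\<rho> s)\<^sup>2"
  \<comment> \<open>with \<open>p\<close> as an atom, both half-integer powers of \<open>w\<close> become polynomial: \<open>w * p\<close> and \<open>w\<^sup>2 * p\<close>\<close>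
  define p where "p = w powr (1/2)"
  define Q where "Q = r' * \<kappa> s * w - r s * k' * w - 3 * \<kappa> s * \<rho> s * (r s)\<^sup>2"
  have w: "w > 0" unfolding w_def by (simp add: add_pos_nonneg)
  have p: "p > 0" using w by (simp add: p_def)
  have p3: "w powr (3/2) = w * p" and p5: "w powr (5/2) = w\<^sup>2 * p"
    using w powr_add[of w 1 "1/2"] powr_add[of w 2 "1/2"] by (simp_all add: p_def)
  have W: "((\<lambda>t. 1 + (\<rho> t)\<^sup>2) has_real_derivative 2 * \<rho> s * r s) (at s within I)"
    by (auto intro!: derivative_eq_intros rho)
  have W3: "((\<lambda>t. (1 + (\<rho> t)\<^sup>2) powr (3/2)) has_real_derivative 3 * p * \<rho> s * r s) (at s within I)"
  proof -
    have "((\<lambda>z. z powr (3/2)) has_real_derivative (3/2) * w powr (3/2 - 1)) (at w)"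
      by (rule has_real_derivative_powr[OF w])
    from DERIV_chain2[OF this[unfolded w_def] W] show ?thesis
      by (simp add: p_def w_def mult_ac)
  qed
  have F: "(?F has_real_derivative Q / ((\<kappa> s)\<^sup>2 * (w\<^sup>2 * p))) (at s within I)"
  proof -
    have "\<kappa> s * (1 + (\<rho> s)\<^sup>2) powr (3/2) \<noteq> 0" using k0 w p by (simp add: w_def[symmetric] p3)
    from DERIV_divide[OF r DERIV_mult[OF k W3] this] show ?thesis
    proof (rule DERIV_cong)
      show "(r' * (\<kappa> s * (1 + (\<rho> s)\<^sup>2) powr (3/2))
          - r s * (k' * (1 + (\<rho> s)\<^sup>2) powr (3/2) + 3 * p * \<rho> s * r s * \<kappa> s))
          / (\<kappa> s * (1 + (\<rho> s)\<^sup>2) powr (3/2) * (\<kappa> s * (1 + (\<rho> s)\<^sup>2) powr (3/2)))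
          = Q / ((\<kappa> s)\<^sup>2 * (w\<^sup>2 * p))"
        using k0 w p unfolding w_def[symmetric] p3
        by (simp add: Q_def divide_simps) (simp add: algebra_simps power2_eq_square)
    qed
  qed
  have dF: "deriv_on I ?F s = Q / ((\<kappa> s)\<^sup>2 * (w\<^sup>2 * p))"
    by (rule deriv_on_eqI[OF assms(1) F[unfolded has_real_derivative_iff_has_vector_derivative]])
  have b: "(?b has_real_derivative - l * (\<kappa> s * \<rho> s) - (l * Q + \<mu> * r') / (r s)\<^sup>2) (at s within I)"
  proof (rule DERIV_cong)
    have "((\<lambda>t. \<mu> + l * \<kappa> t * (1 + (\<rho> t)\<^sup>2)) has_real_derivative
        l * k' * w + l * \<kappa> s * (2 * \<rho> s * r s)) (at s within I)"
      by (auto intro!: derivative_eq_intros k rho simp: w_def algebra_simps)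
    from DERIV_mult[OF DERIV_divide[OF DERIV_const r r0] this]
    show "(?b has_real_derivative (0 * r s - 1 * r') / (r s * r s) * (\<mu> + l * \<kappa> s * w)
        + (l * k' * w + l * \<kappa> s * (2 * \<rho> s * r s)) * (1 / r s)) (at s within I)"
      unfolding w_def .
    show "(0 * r s - 1 * r') / (r s * r s) * (\<mu> + l * \<kappa> s * w)
        + (l * k' * w + l * \<kappa> s * (2 * \<rho> s * r s)) * (1 / r s)
        = - l * (\<kappa> s * \<rho> s) - (l * Q + \<mu> * r') / (r s)\<^sup>2"
      using r0 by (simp add: Q_def divide_simps) (simp add: algebra_simps power2_eq_square)
  qed
  have "(?b has_real_derivative - l * (\<kappa> s * \<rho> s)) (at s within I) \<longleftrightarrow> l * Q + \<mu> * r' = 0"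
    using b r0 vector_derivative_unique_within[OF assms(1)]
    unfolding has_real_derivative_iff_has_vector_derivative by fastforce
  also have "\<dots> \<longleftrightarrow> Q = m * r'"
    using l unfolding mu by (auto simp: algebra_simps)
  also have "\<dots> \<longleftrightarrow> Q / ((\<kappa> s)\<^sup>2 * (w\<^sup>2 * p)) = m * (r' / ((\<kappa> s)\<^sup>2 * (w\<^sup>2 * p)))"
    using k0 w p by (simp add: field_simps)
  finally show ?thesis unfolding dF w_def[symmetric] p5 by simp
qed

section \<open>Concircular fields along a curve\<close>

text \<open>With tangential coefficient \<open>\<rho>b\<close> the normal component of the derivative cancels; the condition
  on \<open>b'\<close> removes the binormal one, and the value of \<open>b\<close> is what leaves \<open>\<mu>\<close> on the tangent.\<close>

lemma frenet_combination_has_derivative: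
  assumes "unit_speed_curve I \<gamma>" "\<forall>s\<in>I. curvature I \<gamma> s > 0" "s \<in> I"
    and rho: "((\<lambda>t. torsion I \<gamma> t / curvature I \<gamma> t) has_real_derivative r) (at s within I)"
    and b: "(b has_real_derivative - l * torsion I \<gamma> s) (at s within I)"
    and br: "r * b s = \<mu> + l * curvature I \<gamma> s * (1 + (torsion I \<gamma> s / curvature I \<gamma> s)\<^sup>2)"
  shows "((\<lambda>t. b t *\<^sub>R ((torsion I \<gamma> t / curvature I \<gamma> t) *\<^sub>R frenet_T I \<gamma> t + frenet_B I \<gamma> t)
            + l *\<^sub>R frenet_N I \<gamma> t) has_vector_derivative \<mu> *\<^sub>R frenet_T I \<gamma> s) (at s within I)"
proof -
  let ?T = "frenet_T I \<gamma>" and ?N = "frenet_N I \<gamma>" and ?B = "frenet_B I \<gamma>"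
    and ?k = "curvature I \<gamma>" and ?t = "torsion I \<gamma>"
  define q where "q = ?t s / ?k s"
  note FE = frenet_equations[OF assms(1-3)]
  have k0: "?k s > 0" using assms by auto
  then have t: "?t s = ?k s * q" by (simp add: q_def)
  have 1: "r * b s = \<mu> + l * ?k s * (1 + q\<^sup>2)" using br by (simp add: q_def)
  show ?thesis
  proof (rule has_vector_derivative_eq_rhs)
    show "((\<lambda>t. b t *\<^sub>R ((?t t / ?k t) *\<^sub>R ?T t + ?B t) + l *\<^sub>R ?N t) has_vector_derivative
       (b s *\<^sub>R (((?t s / ?k s) *\<^sub>R (?k s *\<^sub>R ?N s) + r *\<^sub>R ?T s) + - ?t s *\<^sub>R ?N s)
         + (- l * ?t s) *\<^sub>R ((?t s / ?k s) *\<^sub>R ?T s + ?B s))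
        + l *\<^sub>R (- ?k s *\<^sub>R ?T s + ?t s *\<^sub>R ?B s)) (at s within I)"
      using FE rho b
      by (intro has_vector_derivative_add has_vector_derivative_scaleR
          bounded_linear.has_vector_derivative[OF bounded_linear_scaleR_right]) auto
    have "(r * b s - l * ?k s * (1 + q\<^sup>2)) *\<^sub>R ?T s = \<mu> *\<^sub>R ?T s" by (simp add: 1)
    then show "(b s *\<^sub>R (((?t s / ?k s) *\<^sub>R (?k s *\<^sub>R ?N s) + r *\<^sub>R ?T s) + - ?t s *\<^sub>R ?N s)
         + (- l * ?t s) *\<^sub>R ((?t s / ?k s) *\<^sub>R ?T s + ?B s))
        + l *\<^sub>R (- ?k s *\<^sub>R ?T s + ?t s *\<^sub>R ?B s) = \<mu> *\<^sub>R ?T s"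
      unfolding q_def[symmetric] t
      by (simp add: algebra_simps power2_eq_square)
  qed
qed

text \<open>The converse reading of the three component equations. The normal component being constant
  first forces the tangential component to be \<open>\<rho>b\<close>; differentiating that component once directly
  and once as the product \<open>\<rho>b\<close> then determines \<open>b\<close>.\<close>

lemma concircular_axis_binormal_coefficient:
  assumes "unit_speed_curve I \<gamma>" "\<forall>s\<in>I. curvature I \<gamma> s > 0" "s \<in> I"
    and rho: "((\<lambda>t. torsion I \<gamma> t / curvature I \<gamma> t) has_real_derivative r) (at s within I)"
    and const: "\<forall>t\<in>I. frenet_N I \<gamma> t \<bullet> concircular_field \<mu> v (\<gamma> t) = l"
  defines "b \<equiv> \<lambda>t. concircular_field \<mu> v (\<gamma> t) \<bullet> frenet_B I \<gamma> t"
  shows "(b has_real_derivative - l * torsion I \<gamma> s) (at s within I)"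
    and "r * b s = \<mu> + l * curvature I \<gamma> s * (1 + (torsion I \<gamma> s / curvature I \<gamma> s)\<^sup>2)"
proof -
  let ?T = "frenet_T I \<gamma>" and ?N = "frenet_N I \<gamma>" and ?B = "frenet_B I \<gamma>"
    and ?k = "curvature I \<gamma>" and ?t = "torsion I \<gamma>"
  let ?V = "\<lambda>t. concircular_field \<mu> v (\<gamma> t)"
  note fr = unit_speed_curve_frame[OF assms(1,2)]
  note FE = frenet_equations[OF assms(1,2)]
  have sm: "smooth_on I \<gamma>" using assms(1) by (simp add: unit_speed_curve_def)
  have V: "(?V has_vector_derivative \<mu> *\<^sub>R ?T t) (at t within I)" if "t \<in> I" for t
    using smooth_on_has_vector_derivative[OF sm that, of 0]
    unfolding concircular_field_def
    by (auto simp: frenet_T_def has_vector_derivative_add_const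
        intro!: bounded_linear.has_vector_derivative[OF bounded_linear_scaleR_right])
  have orth: "?T t \<bullet> ?B t = 0" "?T t \<bullet> ?N t = 0" "?T t \<bullet> ?T t = 1" if "t \<in> I" for t
    using fr(2,4)[OF that] by (simp_all add: frenet_B_def dot_cross_self dot_square_norm)
  have cN: "?V t \<bullet> ?N t = l" if "t \<in> I" for t
    using const that by (simp add: inner_commute)
  have a: "?V t \<bullet> ?T t = ?t t / ?k t * b t" if "t \<in> I" for t
  proof -
    have "?V t \<bullet> (- ?k t *\<^sub>R ?T t + ?t t *\<^sub>R ?B t) + (\<mu> *\<^sub>R ?T t) \<bullet> ?N t = 0"
      by (rule has_real_derivative_const_on_imp_0[OF fr(1)[OF that] that
            has_vector_derivative_inner_within[OF V[OF that] FE(2)[OF that]] cN])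
    moreover have "?k t > 0" using assms(2) that by auto
    ultimately show ?thesis
      using orth[OF that] by (simp add: inner_add_right inner_diff_right b_def field_simps)
  qed
  have "(b has_vector_derivative ?V s \<bullet> (- ?t s *\<^sub>R ?N s) + (\<mu> *\<^sub>R ?T s) \<bullet> ?B s) (at s within I)"
    unfolding b_def by (rule has_vector_derivative_inner_within[OF V[OF assms(3)] FE(3)[OF assms(3)]])
  then show b': "(b has_real_derivative - l * ?t s) (at s within I)"
    using orth[OF assms(3)] cN[OF assms(3)]
    by (simp add: has_real_derivative_iff_has_vector_derivative mult.commute)
  have "((\<lambda>t. ?V t \<bullet> ?T t) has_vector_derivative ?V s \<bullet> (?k s *\<^sub>R ?N s) + (\<mu> *\<^sub>R ?T s) \<bullet> ?T s) (at s within I)"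
    by (rule has_vector_derivative_inner_within[OF V[OF assms(3)] FE(1)[OF assms(3)]])
  then have 1: "((\<lambda>t. ?V t \<bullet> ?T t) has_vector_derivative ?k s * l + \<mu>) (at s within I)"
    using orth[OF assms(3)] cN[OF assms(3)] by simp
  have "((\<lambda>t. ?t t / ?k t * b t) has_vector_derivative ?t s / ?k s * (- l * ?t s) + r * b s) (at s within I)"
    using has_vector_derivative_mult rho b'
    unfolding has_real_derivative_iff_has_vector_derivative by blast
  then have "((\<lambda>t. ?V t \<bullet> ?T t) has_vector_derivative ?t s / ?k s * (- l * ?t s) + r * b s) (at s within I)"
    by (rule has_vector_derivative_transform[OF assms(3), rotated]) (simp add: a)
  from vector_derivative_unique_within[OF fr(1)[OF assms(3)] 1 this]
  have "r * b s = \<mu> + l * ?k s + l * (?t s / ?k s * ?t s)" by (simp add: algebra_simps)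
  then show "r * b s = \<mu> + l * ?k s * (1 + (?t s / ?k s)\<^sup>2)"
    using assms(2,3) by (auto simp: field_simps power2_eq_square)
qed

text \<open>The difference \<open>V - \<mu>\<gamma>\<close> has zero derivative, hence is constant because an interval is convex.\<close>

lemma concircular_of_derivative_tangent:
  assumes "unit_speed_curve I \<gamma>"
    and V: "\<And>s. s \<in> I \<Longrightarrow> (V has_vector_derivative \<mu> *\<^sub>R frenet_T I \<gamma> s) (at s within I)"
  shows "\<exists>v. \<forall>s\<in>I. V s = concircular_field \<mu> v (\<gamma> s)"
proof -
  have sm: "smooth_on I \<gamma>" and "convex I"
    using assms(1) by (auto simp: unit_speed_curve_def is_interval_convex)
  have "((\<lambda>s. V s - \<mu> *\<^sub>R \<gamma> s) has_vector_derivative \<mu> *\<^sub>R frenet_T I \<gamma> s - \<mu> *\<^sub>R frenet_T I \<gamma> s) (at s within I)"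
    if "s \<in> I" for s
    using smooth_on_has_vector_derivative[OF sm that, of 0]
    by (intro has_vector_derivative_diff V[OF that]
        bounded_linear.has_vector_derivative[OF bounded_linear_scaleR_right])
      (simp add: frenet_T_def)
  then have "\<exists>v. \<forall>s\<in>I. V s - \<mu> *\<^sub>R \<gamma> s = v"
    using has_derivative_zero_constant[OF \<open>convex I\<close>, of "\<lambda>s. V s - \<mu> *\<^sub>R \<gamma> s"]
    by (auto simp: has_vector_derivative_def)
  then show ?thesis
    unfolding concircular_field_def by (metis add.commute diff_add_cancel)
qed

section \<open>Characterization of proper concircular helices\<close>

theorem theorem2p4:
  fixes I :: "real set" and \<gamma> :: "real \<Rightarrow> real^3" and \<kappa> \<tau> \<rho> \<rho>' \<rho>'' :: "real \<Rightarrow> real"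
    and T N B :: "real \<Rightarrow> real^3" and ode :: "real \<Rightarrow> bool"
  assumes "unit_speed_curve I \<gamma>"
    and "T = frenet_T I \<gamma>" and "N = frenet_N I \<gamma>" and "B = frenet_B I \<gamma>"
    and "\<kappa> = curvature I \<gamma>" and "\<tau> = torsion I \<gamma>"
    and "\<forall>s\<in>I. \<kappa> s > 0"
    and "\<rho> = (\<lambda>s. \<tau> s / \<kappa> s)"
    and "\<rho>' = deriv_on I \<rho>" and "\<rho>'' = deriv_on I \<rho>'"
    and "\<forall>s\<in>I. \<rho>' s \<noteq> 0"
    and "\<And>m. ode m \<longleftrightarrow>
           (\<forall>s\<in>I. deriv_on I (\<lambda>t. \<rho>' t / (\<kappa> t * (1 + (\<rho> t)\<^sup>2) powr (3/2))) s
                  = m * (\<rho>'' s / ((\<kappa> s)\<^sup>2 * (1 + (\<rho> s)\<^sup>2) powr (5/2))))"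
  shows "(proper_concircular_helix I \<gamma> \<longleftrightarrow> (\<exists>m. m \<noteq> 0 \<and> ode m)) \<and>
    (\<forall>m l \<mu>. m \<noteq> 0 \<and> ode m \<and> l \<noteq> 0 \<and> \<mu> \<noteq> 0 \<and> \<mu> = - l * m \<longrightarrow>
      (let b = (\<lambda>s. 1 / \<rho>' s * (\<mu> + l * \<kappa> s * (1 + (\<rho> s)\<^sup>2)));
           V = (\<lambda>s. b s *\<^sub>R (\<rho> s *\<^sub>R T s + B s) + l *\<^sub>R N s)
       in \<exists>v. (\<forall>s\<in>I. V s = concircular_field \<mu> v (\<gamma> s)) \<and>
              concircular_helix_with_axis I \<gamma> (concircular_field \<mu> v) \<and>
              (\<forall>s\<in>I. N s \<bullet> concircular_field \<mu> v (\<gamma> s) = l)))"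
proof -
  note kp = assms(7)[unfolded assms(5)]
  have rho: "\<rho> = (\<lambda>s. torsion I \<gamma> s / curvature I \<gamma> s)" by (simp add: assms)
  note fr = unit_speed_curve_frame[OF assms(1) kp]
  define b where "b \<mu> l = (\<lambda>s. 1 / \<rho>' s * (\<mu> + l * \<kappa> s * (1 + (\<rho> s)\<^sup>2)))" for \<mu> l
  define V where "V \<mu> l = (\<lambda>s. b \<mu> l s *\<^sub>R (\<rho> s *\<^sub>R T s + B s) + l *\<^sub>R N s)" for \<mu> l
  have r1: "(\<rho> has_real_derivative \<rho>' s) (at s within I)"
    and r2: "(\<rho>' has_real_derivative \<rho>'' s) (at s within I)" if "s \<in> I" for s
    using torsion_curvature_ratio_twice_differentiable[OF assms(1) kp that]
    by (simp_all add: assms)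
  have tau: "\<kappa> s * \<rho> s = \<tau> s" if "s \<in> I" for s
    using assms(7) that by (auto simp: assms(8))
  have ode_b: "ode m \<longleftrightarrow> (\<forall>s\<in>I. (b \<mu> l has_real_derivative - l * \<tau> s) (at s within I))"
    if "l \<noteq> 0" "\<mu> = - l * m" for m l \<mu>
  proof -
    have "deriv_on I (\<lambda>t. \<rho>' t / (\<kappa> t * (1 + (\<rho> t)\<^sup>2) powr (3/2))) s
            = m * (\<rho>'' s / ((\<kappa> s)\<^sup>2 * (1 + (\<rho> s)\<^sup>2) powr (5/2)))
        \<longleftrightarrow> (b \<mu> l has_real_derivative - l * \<tau> s) (at s within I)" if s: "s \<in> I" for s
    proof -
      obtain k' where k': "(\<kappa> has_real_derivative k') (at s within I)"
        using curvature_has_real_derivative[OF assms(1) kp s] unfolding assms(5) by blast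
      show ?thesis
        unfolding b_def tau[OF s, symmetric]
        by (rule ode_iff_binormal_coefficient[OF fr(1)[OF s] k' _ r1[OF s] _ r2[OF s] \<open>l \<noteq> 0\<close> \<open>\<mu> = - l * m\<close>])
          (use assms(7,11) s in auto)
    qed
    then show ?thesis unfolding assms(12) by blast
  qed
  have br: "\<rho>' s * b \<mu> l s = \<mu> + l * \<kappa> s * (1 + (\<rho> s)\<^sup>2)" if "s \<in> I" for s \<mu> l
    using assms(11) that by (auto simp: b_def)
  have axis: "\<exists>v. (\<forall>s\<in>I. V \<mu> l s = concircular_field \<mu> v (\<gamma> s)) \<and>
              concircular_helix_with_axis I \<gamma> (concircular_field \<mu> v) \<and>
              (\<forall>s\<in>I. N s \<bullet> concircular_field \<mu> v (\<gamma> s) = l)"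
    if "ode m" "l \<noteq> 0" "\<mu> = - l * m" for m l \<mu>
  proof -
    have "(V \<mu> l has_vector_derivative \<mu> *\<^sub>R frenet_T I \<gamma> s) (at s within I)" if "s \<in> I" for s
      unfolding V_def rho assms(2-4)
      by (rule frenet_combination_has_derivative[OF assms(1) kp that])
        (use r1[OF that] br[OF that] ode_b[OF \<open>l \<noteq> 0\<close> \<open>\<mu> = - l * m\<close>] \<open>ode m\<close> that
          in \<open>auto simp: rho assms(5,6)\<close>)
    then obtain v where v: "\<forall>s\<in>I. V \<mu> l s = concircular_field \<mu> v (\<gamma> s)"
      using concircular_of_derivative_tangent[OF assms(1)] by blast
    have "N s \<bullet> V \<mu> l s = l" if "s \<in> I" for s
      using fr(3,4)[OF that]
      by (simp add: V_def assms(2-4) frenet_B_def inner_add_right dot_cross_self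
          dot_square_norm inner_commute)
    then have "\<forall>s\<in>I. N s \<bullet> concircular_field \<mu> v (\<gamma> s) = l" using v by simp
    then show ?thesis
      using v assms(1) kp unfolding concircular_helix_with_axis_def assms(3) by blast
  qed
  have "\<exists>m. m \<noteq> 0 \<and> ode m" if helix: "proper_concircular_helix I \<gamma>"
  proof -
    obtain \<mu> v l where l: "\<forall>s\<in>I. frenet_N I \<gamma> s \<bullet> concircular_field \<mu> v (\<gamma> s) = l" "l * \<mu> \<noteq> 0"
      using helix unfolding proper_concircular_helix_def by blast
    define \<beta> where "\<beta> t = concircular_field \<mu> v (\<gamma> t) \<bullet> frenet_B I \<gamma> t" for t
    have \<beta>: "(\<beta> has_real_derivative - l * \<tau> s) (at s within I)"
      "\<rho>' s * \<beta> s = \<mu> + l * \<kappa> s * (1 + (\<rho> s)\<^sup>2)" if "s \<in> I" for s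
      using concircular_axis_binormal_coefficient[OF assms(1) kp that r1[OF that, unfolded rho] l(1)]
      unfolding \<beta>_def by (simp_all add: assms(5,6) rho)
    \<comment> \<open>the binormal component of an axis can only be the explicit \<open>b\<close>, since \<open>\<rho>'\<close> does not vanish\<close>
    have eq: "b \<mu> l s = \<beta> s" if "s \<in> I" for s
    proof -
      have "\<rho>' s * b \<mu> l s = \<rho>' s * \<beta> s" using br[OF that] \<beta>(2)[OF that] by simp
      then show ?thesis using assms(11) that by simp
    qed
    have "(b \<mu> l has_real_derivative - l * \<tau> s) (at s within I)" if "s \<in> I" for s
      using \<beta>(1)[OF that] unfolding has_real_derivative_iff_has_vector_derivative
      by (rule has_vector_derivative_transform[OF that, rotated]) (simp add: eq)
    then have "ode (- \<mu> / l)" using ode_b[of l \<mu> "- \<mu> / l"] l(2) by simp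
    then show ?thesis using l(2) by (intro exI[of _ "- \<mu> / l"]) simp
  qed
  moreover have "proper_concircular_helix I \<gamma>" if "m \<noteq> 0" "ode m" for m
  proof -
    obtain v where "concircular_helix_with_axis I \<gamma> (concircular_field (- m) v)"
      "\<forall>s\<in>I. N s \<bullet> concircular_field (- m) v (\<gamma> s) = 1"
      using axis[of m 1 "- m"] \<open>ode m\<close> by auto
    then show ?thesis
      using \<open>m \<noteq> 0\<close> unfolding proper_concircular_helix_def assms(3)
      by (intro exI[of _ "- m"] exI[of _ v] exI[of _ 1]) simp
  qed
  ultimately have "proper_concircular_helix I \<gamma> \<longleftrightarrow> (\<exists>m. m \<noteq> 0 \<and> ode m)" by blast
  then show ?thesis
    unfolding Let_def
    by (intro conjI allI impI) (simp, rule axis[unfolded V_def b_def], auto)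
qed

end
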